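(* Let $1\le r\le k-1$, let $H_k$ be the saturated two-level design generated by $k$ independent columns $a_1,\ldots,a_k$, and let $H_r\subset H_k$ be the saturated design generated by the $r$ independent columns $a_1,\ldots,a_r$. Let $D_2$ and $D_3$ be any disjoint sets of columns with $D_2\cup D_3=H_r$. Then the pair $(D_2,D_3)$ maximizes $$g(D_2,D_3)=3A_3(D_3)+2E_3^{(1)}(D_2,D_3)+E_3^{(2)}(D_2,D_3)$$ among all pairs of disjoint sets of columns of $H_k$ with the same respective numbers of columns. Therefore, with $D_1=H_k\setminus H_r$, the design pair $(D_1,D_2)$ has minimum weak aberration.
   Context: The saturated design $H_k$ has $2^k$ runs and $2^k-1$ factors; its columns are all entrywise products of nonempty subsets of $k$ independent $\pm1$ columns $a_1,\ldots,a_k$ (the columns of a full $2^k$ factorial). $H_r$ consists of the $2^r-1$ columns of $H_k$ that are entrywise products of nonempty subsets of $\{a_1,\ldots,a_r\}$. For a set $D$ of columns of $H_k$, a defining word of length $i$ in $D$ is a set of $i$ columns (letters) of $D$ whose entrywise product is the all-ones column; $A_i(D)$ is the number of these. $E_3^{(p)}(D_2,D_3)$ is the number of length-3 defining words in $D_2\cup D_3$ that have exactly $p$ letters from $D_2$. $B_2(D_1,D_2)$ is the number of length-3 defining words in $(D_1,D_2)$ that have two letters from $D_1$ and one letter from $D_2$. For disjoint sets of columns $D_1,D_2$ of $H_k$ put $N_2(D_1,D_2)=3A_3(D_1)+B_2(D_1,D_2)$. A pair $(D_1,D_2)$ has minimum weak aberration if it minimizes $N_2(D_1,D_2)$ among all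 pairs of disjoint sets of columns of $H_k$ with the same respective numbers of columns. *)

theory Defs
  imports Main "HOL-Library.FuncSet"
begin

text \<open>
  Runs are the elements of the type \<open>'r\<close> and a column is a function \<open>'r \<Rightarrow> int\<close>.
  The columns \<open>a 1, \<dots>, a k\<close> form a full factorial iff every level combination
  occurs in exactly one run, so that \<open>'r\<close> has exactly \<open>2 ^ k\<close> elements.
\<close>

definition full_factorial :: "nat \<Rightarrow> (nat \<Rightarrow> 'r \<Rightarrow> int) \<Rightarrow> bool" where
  "full_factorial k a \<longleftrightarrow>
     bij_betw (\<lambda>x. \<lambda>i\<in>{1..k}. a i x) UNIV ({1..k} \<rightarrow>\<^sub>E {-1, 1})"

definition saturated :: "(nat \<Rightarrow> 'r \<Rightarrow> int) \<Rightarrow> nat \<Rightarrow> ('r \<Rightarrow> int) set" where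
  "saturated a m = {(\<lambda>x. \<Prod>i\<in>S. a i x) | S. S \<subseteq> {1..m} \<and> S \<noteq> {}}"

definition defining_word :: "nat \<Rightarrow> ('r \<Rightarrow> int) set \<Rightarrow> ('r \<Rightarrow> int) set \<Rightarrow> bool" where
  "defining_word i D W \<longleftrightarrow>
     W \<subseteq> D \<and> finite W \<and> card W = i \<and> (\<lambda>x. \<Prod>c\<in>W. c x) = (\<lambda>x. 1)"

definition A :: "nat \<Rightarrow> ('r \<Rightarrow> int) set \<Rightarrow> nat" where
  "A i D = card {W. defining_word i D W}"

definition E3 :: "nat \<Rightarrow> ('r \<Rightarrow> int) set \<Rightarrow> ('r \<Rightarrow> int) set \<Rightarrow> nat" where
  "E3 p D2 D3 = card {W. defining_word 3 (D2 \<union> D3) W \<and> card (W \<inter> D2) = p}"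

definition B2 :: "('r \<Rightarrow> int) set \<Rightarrow> ('r \<Rightarrow> int) set \<Rightarrow> nat" where
  "B2 D1 D2 = card {W. defining_word 3 (D1 \<union> D2) W \<and>
                       card (W \<inter> D1) = 2 \<and> card (W \<inter> D2) = 1}"

definition N2 :: "('r \<Rightarrow> int) set \<Rightarrow> ('r \<Rightarrow> int) set \<Rightarrow> nat" where
  "N2 D1 D2 = 3 * A 3 D1 + B2 D1 D2"

definition g :: "('r \<Rightarrow> int) set \<Rightarrow> ('r \<Rightarrow> int) set \<Rightarrow> nat" where
  "g D2 D3 = 3 * A 3 D3 + 2 * E3 1 D2 D3 + E3 2 D2 D3"

definition disjoint_pair ::
    "('r \<Rightarrow> int) set \<Rightarrow> ('r \<Rightarrow> int) set \<Rightarrow> ('r \<Rightarrow> int) set \<Rightarrow> bool" where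
  "disjoint_pair H C D \<longleftrightarrow> C \<subseteq> H \<and> D \<subseteq> H \<and> C \<inter> D = {}"

definition maximizes_g ::
    "('r \<Rightarrow> int) set \<Rightarrow> ('r \<Rightarrow> int) set \<Rightarrow> ('r \<Rightarrow> int) set \<Rightarrow> bool" where
  "maximizes_g H D2 D3 \<longleftrightarrow> disjoint_pair H D2 D3 \<and>
     (\<forall>D2' D3'. disjoint_pair H D2' D3' \<and> card D2' = card D2 \<and> card D3' = card D3
        \<longrightarrow> g D2' D3' \<le> g D2 D3)"

definition min_weak_aberration ::
    "('r \<Rightarrow> int) set \<Rightarrow> ('r \<Rightarrow> int) set \<Rightarrow> ('r \<Rightarrow> int) set \<Rightarrow> bool" where
  "min_weak_aberration H D1 D2 \<longleftrightarrow> disjoint_pair H D1 D2 \<and>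
     (\<forall>D1' D2'. disjoint_pair H D1' D2' \<and> card D1' = card D1 \<and> card D2' = card D2
        \<longrightarrow> N2 D1 D2 \<le> N2 D1' D2')"

end

theory Submission
  imports Defs "HOL-Library.Function_Algebras"
begin

text \<open>
  Under entrywise multiplication, the columns of a saturated design together with the all-ones
  column form an elementary abelian \<open>2\<close>-group.  A defining word of length three is therefore a line
  \<open>{x, y, x * y}\<close>, determined by any two of its letters.  Hence weighted counts of words can be
  replaced by counts of ordered pairs of columns whose product lies in a prescribed set
  (lemma \<open>card_closed_pairs\<close>), and both criteria become such counts.

  \<^item> With \<open>D = D2 \<union> D3\<close>, the number \<open>g D2 D3\<close> weights each word in \<open>D\<close> by its number of letters in
    \<open>D3\<close>.  So \<open>2 * g D2 D3\<close> counts the pairs \<open>x \<in> D3\<close>, \<open>y \<in> D - {x}\<close> with \<open>x * y \<in> D\<close>.  This is at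
    most \<open>card D3 * (card D - 1)\<close>, with equality when \<open>D\<close> is closed under products of distinct
    columns, as \<open>H\<^sub>r\<close> is.

  \<^item> \<open>2 * N2 D1 D2\<close> counts the ordered pairs of distinct \<open>x, y \<in> D1\<close> with \<open>x * y \<in> D1 \<union> D2\<close>.  Let
    \<open>D3\<close> be the complement of \<open>D1 \<union> D2\<close>.  For fixed \<open>x\<close>, translation by \<open>x\<close> is injective, so at most
    \<open>card D3\<close> of the columns \<open>y\<close> are lost because \<open>x * y \<in> D3\<close>.  Exactly \<open>card D3\<close> are lost when
    \<open>D1 = H\<^sub>k - H\<^sub>r\<close>, because the complement of a subgroup is invariant under translation by
    elements of the subgroup.

  Both bounds depend only on the numbers of columns, which gives both optimality claims.
\<close>

section \<open>Column sets closed under products\<close>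

text \<open>
  \<open>H\<close> plays the role of the non-identity elements of an elementary abelian \<open>2\<close>-group of columns, or
  of the points of a finite projective space over the field with two elements.
\<close>

locale column_space =
  fixes H :: "('r \<Rightarrow> int) set"
  assumes finite_columns: "finite H"
    and square_column: "x \<in> H \<Longrightarrow> x * x = 1"
    and one_not_column: "1 \<notin> H"
    and mult_closed: "x \<in> H \<Longrightarrow> y \<in> H \<Longrightarrow> x \<noteq> y \<Longrightarrow> x * y \<in> H"
begin

lemma finite_subset_columns: "X \<subseteq> H \<Longrightarrow> finite X"
  using finite_columns finite_subset by blast

lemma mult_cancel_column: "x \<in> H \<Longrightarrow> x * (x * y) = y"
  by (simp add: square_column flip: mult.assoc)

lemma inj_on_mult_column: "x \<in> H \<Longrightarrow> inj_on ((*) x) B"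
  by (metis inj_onI mult_cancel_column)

lemma mult_neq_left: "x \<in> H \<Longrightarrow> y \<in> H \<Longrightarrow> x * y \<noteq> x"
  by (metis mult_cancel_column one_not_column square_column)

lemma mult_neq_right: "x \<in> H \<Longrightarrow> y \<in> H \<Longrightarrow> x * y \<noteq> y"
  by (metis mult.commute mult_neq_left)

end

section \<open>Words of length three as lines\<close>

abbreviation words3 :: "('r \<Rightarrow> int) set \<Rightarrow> ('r \<Rightarrow> int) set set" where
  "words3 D \<equiv> {W. defining_word 3 D W}"

definition closed_pairs ::
    "('r \<Rightarrow> int) set \<Rightarrow> ('r \<Rightarrow> int) set \<Rightarrow> ('r \<Rightarrow> int) set \<Rightarrow> (('r \<Rightarrow> int) \<times> ('r \<Rightarrow> int)) set" where
  "closed_pairs X Y D = (SIGMA x:X. {y \<in> Y - {x}. x * y \<in> D})"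

lemma finite_words3: "finite D \<Longrightarrow> finite (words3 D)"
  by (rule finite_subset[of _ "Pow D"]) (auto simp: defining_word_def)

lemma words3_card: "W \<in> words3 D \<Longrightarrow> card W = 3"
  and words3_subset: "W \<in> words3 D \<Longrightarrow> W \<subseteq> D"
  and words3_finite: "W \<in> words3 D \<Longrightarrow> finite W"
  by (auto simp: defining_word_def)

context column_space
begin

text \<open>
  Since every column is its own inverse, the third letter of a word is the product of the other two.
\<close>

lemma word3_eq_line:
  assumes W: "W \<in> words3 D" and D: "D \<subseteq> H" and x: "x \<in> W" and y: "y \<in> W" and ne: "x \<noteq> y"
  shows "W = {x, y, x * y}"
proof -
  have sub: "W \<subseteq> H" and fin: "finite W" and card: "card W = 3"
    and one: "(\<lambda>r. \<Prod>c\<in>W. c r) = (\<lambda>r. 1)"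
    using W D by (auto simp: defining_word_def)
  have "card (W - {x, y}) = 1"
    using fin card x y ne by (simp add: card_Diff_subset)
  then obtain z where z: "W - {x, y} = {z}"
    by (auto simp: card_1_singleton_iff)
  then have W_eq: "W = {x, y, z}" and "z \<noteq> x" "z \<noteq> y"
    using x y by auto
  then have distinct: "x \<notin> {y, z}" "y \<notin> {z}"
    using ne by auto
  have "x * y * z = 1"
  proof
    fix r
    have "(\<Prod>c\<in>{x, y, z}. c r) = 1"
      using fun_cong[OF one, of r] unfolding W_eq .
    then show "(x * y * z) r = 1 r"
      using distinct by (simp add: mult.assoc)
  qed
  moreover have "z * z = 1"
    using W_eq sub by (intro square_column) auto
  ultimately have "z = x * y"
    by (metis mult.assoc mult.left_neutral mult.right_neutral)
  with W_eq show ?thesis by simp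
qed

lemma line_in_words3:
  assumes "D \<subseteq> H" "x \<in> D" "y \<in> D" "x \<noteq> y" "x * y \<in> D"
  shows "{x, y, x * y} \<in> words3 D"
proof -
  have H: "x \<in> H" "y \<in> H" using assms by auto
  then have ne: "x * y \<noteq> x" "x * y \<noteq> y" by (simp_all add: mult_neq_left mult_neq_right)
  have "(x * y) * (x * y) = 1"
    using assms by (intro square_column) auto
  then have "\<And>r. x r * (y r * (x r * y r)) = 1"
    by (simp add: fun_eq_iff mult.assoc)
  then show ?thesis
    using assms ne[symmetric] by (simp add: defining_word_def)
qed

text \<open>
  The double count behind both criteria: an ordered pair of distinct columns with product in \<open>D\<close> lies
  on exactly one line, and a line \<open>W\<close> contains \<open>card (W \<inter> X) * (card (W \<inter> Y) - 1)\<close> of the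
  pairs considered.
\<close>

lemma card_closed_pairs:
  assumes D: "D \<subseteq> H" and XY: "X \<subseteq> Y" and YD: "Y \<subseteq> D"
  shows "card (closed_pairs X Y D) = (\<Sum>W\<in>words3 D. card (W \<inter> X) * (card (W \<inter> Y) - 1))"
proof -
  let ?P = "\<lambda>W. SIGMA x:W \<inter> X. (W \<inter> Y) - {x}"
  have finW: "finite (words3 D)"
    by (intro finite_words3 finite_subset[OF D] finite_columns)
  have "closed_pairs X Y D = (\<Union>W\<in>words3 D. ?P W)"
  proof (intro set_eqI iffI)
    fix p assume "p \<in> closed_pairs X Y D"
    then obtain x y where p: "p = (x, y)" and xy: "x \<in> X" "y \<in> Y" "x \<noteq> y" "x * y \<in> D"
      by (auto simp: closed_pairs_def)
    then have "{x, y, x * y} \<in> words3 D"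
      using XY YD D by (intro line_in_words3) auto
    moreover have "p \<in> ?P {x, y, x * y}"
      using p xy by auto
    ultimately show "p \<in> (\<Union>W\<in>words3 D. ?P W)"
      by (intro UN_I)
  next
    fix p assume "p \<in> (\<Union>W\<in>words3 D. ?P W)"
    then obtain x y W where p: "p = (x, y)" and W: "W \<in> words3 D"
      and xy: "x \<in> W" "x \<in> X" "y \<in> W" "y \<in> Y" "x \<noteq> y"
      by auto
    then have "W = {x, y, x * y}"
      by (intro word3_eq_line[OF W D])
    then have "x * y \<in> D"
      using words3_subset[OF W] by auto
    then show "p \<in> closed_pairs X Y D"
      using p xy by (simp add: closed_pairs_def)
  qed
  also have "card \<dots> = (\<Sum>W\<in>words3 D. card (?P W))"
  proof (rule card_UN_disjoint[OF finW])
    show "\<forall>W\<in>words3 D. finite (?P W)"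
      using words3_finite by blast
    show "\<forall>V\<in>words3 D. \<forall>W\<in>words3 D. V \<noteq> W \<longrightarrow> ?P V \<inter> ?P W = {}"
    proof (intro ballI impI, rule ccontr)
      fix V W assume V: "V \<in> words3 D" and W: "W \<in> words3 D" and "V \<noteq> W"
        and "?P V \<inter> ?P W \<noteq> {}"
      then obtain x y where "x \<in> V" "y \<in> V" "x \<in> W" "y \<in> W" "x \<noteq> y"
        by auto
      then have "V = W"
        using word3_eq_line[OF V D, of x y] word3_eq_line[OF W D, of x y] by metis
      with \<open>V \<noteq> W\<close> show False by contradiction
    qed
  qed
  also have "\<dots> = (\<Sum>W\<in>words3 D. card (W \<inter> X) * (card (W \<inter> Y) - 1))"
  proof (rule sum.cong[OF refl])
    fix W assume W: "W \<in> words3 D"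
    then have fin: "finite W" by (rule words3_finite)
    have "card (?P W) = (\<Sum>x\<in>W \<inter> X. card (W \<inter> Y - {x}))"
      using fin by simp
    also have "\<dots> = (\<Sum>x\<in>W \<inter> X. card (W \<inter> Y) - 1)"
      using XY by (intro sum.cong refl card_Diff_singleton) auto
    finally show "card (?P W) = card (W \<inter> X) * (card (W \<inter> Y) - 1)" by simp
  qed
  finally show ?thesis .
qed

section \<open>The two criteria as counts of pairs\<close>

text \<open>
  In a word with \<open>j\<close> letters in \<open>D3\<close>, such a letter can be followed by either of the other two, which
  gives \<open>2 * j\<close> ordered pairs; \<open>g\<close> gives the word weight \<open>j\<close>.
\<close>

lemma twice_g_eq_card_closed_pairs:
  assumes sub: "D2 \<subseteq> H" "D3 \<subseteq> H" and disj: "D2 \<inter> D3 = {}"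
  shows "2 * g D2 D3 = card (closed_pairs D3 (D2 \<union> D3) (D2 \<union> D3))"
proof -
  define D where "D = D2 \<union> D3"
  have D: "D \<subseteq> H" using sub D_def by auto
  have finW: "finite (words3 D)"
    by (intro finite_words3 finite_subset[OF D] finite_columns)
  let ?p = "\<lambda>W. card (W \<inter> D2)"
  have no_D2: "words3 D3 = {W \<in> words3 D. ?p W = 0}"
  proof (intro set_eqI iffI)
    fix W assume "W \<in> words3 D3"
    then show "W \<in> {W \<in> words3 D. ?p W = 0}"
      using disj by (auto simp: defining_word_def D_def)
  next
    fix W assume W: "W \<in> {W \<in> words3 D. ?p W = 0}"
    then have "W \<inter> D2 = {}" by (auto simp: defining_word_def)
    with W show "W \<in> words3 D3" by (auto simp: defining_word_def D_def)
  qed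
  have "g D2 D3 = 3 * card {W \<in> words3 D. ?p W = 0} + 2 * card {W \<in> words3 D. ?p W = 1}
      + card {W \<in> words3 D. ?p W = 2}"
    by (simp add: g_def A_def E3_def D_def[symmetric] no_D2)
  also have "\<dots> = (\<Sum>W\<in>words3 D. 3 * of_bool (?p W = 0) + 2 * of_bool (?p W = 1) + of_bool (?p W = 2))"
    using finW by (simp add: sum.distrib Int_def flip: sum_distrib_left)
  also have "\<dots> = (\<Sum>W\<in>words3 D. card (W \<inter> D3))"
  proof (rule sum.cong[OF refl])
    fix W assume W: "W \<in> words3 D"
    have "card (W \<inter> D2) + card (W \<inter> D3) = card ((W \<inter> D2) \<union> (W \<inter> D3))"
      using words3_finite[OF W] disj by (intro card_Un_disjoint[symmetric]) auto
    also have "(W \<inter> D2) \<union> (W \<inter> D3) = W"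
      using words3_subset[OF W] by (auto simp: D_def)
    finally show "3 * of_bool (?p W = 0) + 2 * of_bool (?p W = 1) + of_bool (?p W = 2)
        = card (W \<inter> D3)"
      using words3_card[OF W] by (auto simp: of_bool_def)
  qed
  finally have "2 * g D2 D3 = (\<Sum>W\<in>words3 D. card (W \<inter> D3) * 2)"
    by (simp add: sum_distrib_left mult.commute)
  also have "\<dots> = (\<Sum>W\<in>words3 D. card (W \<inter> D3) * (card (W \<inter> D) - 1))"
    \<comment> \<open>Every letter of \<open>W\<close> lies in \<open>D\<close>, so the factor \<open>2\<close> is \<open>card W - 1\<close>.\<close>
    by (intro sum.cong refl) (metis Int_absorb2 words3_card words3_subset diff_Suc_1 eval_nat_numeral(3))
  also have "\<dots> = card (closed_pairs D3 D D)"
    by (rule card_closed_pairs[symmetric]) (use D in \<open>auto simp: D_def\<close>)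
  finally show ?thesis by (simp add: D_def)
qed

text \<open>
  A word in \<open>D1 \<union> D2\<close> with \<open>m\<close> letters in \<open>D1\<close> has weight \<open>m * (m - 1)\<close> in \<open>2 * N2 D1 D2\<close>: this is
  \<open>6\<close> for \<open>m = 3\<close>, \<open>2\<close> for \<open>m = 2\<close>, and \<open>0\<close> otherwise.
\<close>

lemma twice_N2_eq_card_closed_pairs:
  assumes sub: "D1 \<subseteq> H" "D2 \<subseteq> H" and disj: "D1 \<inter> D2 = {}"
  shows "2 * N2 D1 D2 = card (closed_pairs D1 D1 (D1 \<union> D2))"
proof -
  define D where "D = D1 \<union> D2"
  have D: "D \<subseteq> H" using sub D_def by auto
  have finW: "finite (words3 D)"
    by (intro finite_words3 finite_subset[OF D] finite_columns)
  let ?m = "\<lambda>W. card (W \<inter> D1)"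
  have split: "?m W + card (W \<inter> D2) = 3" if W: "W \<in> words3 D" for W
  proof -
    have "card (W \<inter> D1) + card (W \<inter> D2) = card ((W \<inter> D1) \<union> (W \<inter> D2))"
      using words3_finite[OF W] disj by (intro card_Un_disjoint[symmetric]) auto
    also have "(W \<inter> D1) \<union> (W \<inter> D2) = W"
      using words3_subset[OF W] by (auto simp: D_def)
    finally show ?thesis using words3_card[OF W] by simp
  qed
  have all_D1: "words3 D1 = {W \<in> words3 D. ?m W = 3}"
  proof (intro set_eqI iffI)
    fix W assume W: "W \<in> words3 D1"
    then have "W \<inter> D1 = W" by (auto simp: defining_word_def)
    with W show "W \<in> {W \<in> words3 D. ?m W = 3}"
      by (auto simp: defining_word_def D_def)
  next
    fix W assume W: "W \<in> {W \<in> words3 D. ?m W = 3}"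
    then have "W \<inter> D1 = W"
      by (intro card_subset_eq) (auto simp: defining_word_def)
    with W show "W \<in> words3 D1" by (auto simp: defining_word_def)
  qed
  have two_D1: "{W. defining_word 3 D W \<and> ?m W = 2 \<and> card (W \<inter> D2) = 1} = {W \<in> words3 D. ?m W = 2}"
    using split by fastforce
  have "N2 D1 D2 = 3 * card {W \<in> words3 D. ?m W = 3} + card {W \<in> words3 D. ?m W = 2}"
    by (simp only: N2_def A_def B2_def D_def[symmetric] all_D1 two_D1)
  also have "\<dots> = (\<Sum>W\<in>words3 D. 3 * of_bool (?m W = 3) + of_bool (?m W = 2))"
    using finW by (simp add: sum.distrib Int_def flip: sum_distrib_left)
  finally have "2 * N2 D1 D2 = (\<Sum>W\<in>words3 D. 2 * (3 * of_bool (?m W = 3) + of_bool (?m W = 2)))"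
    by (simp only: sum_distrib_left)
  also have "\<dots> = (\<Sum>W\<in>words3 D. ?m W * (?m W - 1))"
  proof (rule sum.cong[OF refl])
    fix W assume "W \<in> words3 D"
    then have "?m W \<le> 3" using split by fastforce
    then have "?m W \<in> {0, 1, 2, 3}" by auto
    then show "2 * (3 * of_bool (?m W = 3) + of_bool (?m W = 2)) = ?m W * (?m W - 1)"
      by auto
  qed
  also have "\<dots> = card (closed_pairs D1 D1 D)"
    by (rule card_closed_pairs[symmetric]) (use D in \<open>auto simp: D_def\<close>)
  finally show ?thesis by (simp add: D_def)
qed

section \<open>Bounds depending only on the numbers of columns\<close>

text \<open>
  The bounds for \<open>g\<close> discard the condition \<open>x * y \<in> D2 \<union> D3\<close>; closure is exactly what makes it hold
  for every pair.
\<close>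

lemma twice_g_le:
  assumes sub: "D2 \<subseteq> H" "D3 \<subseteq> H" and disj: "D2 \<inter> D3 = {}"
  shows "2 * g D2 D3 \<le> card D3 * (card D2 + card D3 - 1)"
proof -
  let ?D = "D2 \<union> D3"
  have fin: "finite D2" "finite D3" using sub finite_subset_columns by auto
  have "card (closed_pairs D3 ?D ?D) = (\<Sum>x\<in>D3. card {y \<in> ?D - {x}. x * y \<in> ?D})"
    using fin by (simp add: closed_pairs_def)
  also have "\<dots> \<le> (\<Sum>x\<in>D3. card (?D - {x}))"
    using fin by (intro sum_mono card_mono) auto
  also have "\<dots> = (\<Sum>x\<in>D3. card D2 + card D3 - 1)"
    using fin disj by (intro sum.cong) (auto simp: card_Un_disjoint)
  finally show ?thesis by (simp add: twice_g_eq_card_closed_pairs[OF assms])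
qed

lemma twice_g_eq:
  assumes sub: "D2 \<subseteq> H" "D3 \<subseteq> H" and disj: "D2 \<inter> D3 = {}"
    and closed: "column_space (D2 \<union> D3)"
  shows "2 * g D2 D3 = card D3 * (card D2 + card D3 - 1)"
proof -
  let ?D = "D2 \<union> D3"
  have fin: "finite D2" "finite D3" using sub finite_subset_columns by auto
  have "card (closed_pairs D3 ?D ?D) = (\<Sum>x\<in>D3. card {y \<in> ?D - {x}. x * y \<in> ?D})"
    using fin by (simp add: closed_pairs_def)
  also have "\<dots> = (\<Sum>x\<in>D3. card (?D - {x}))"
  proof (rule sum.cong[OF refl])
    fix x assume "x \<in> D3"
    then have "{y \<in> ?D - {x}. x * y \<in> ?D} = ?D - {x}"
      using column_space.mult_closed[OF closed, of x] by blast
    then show "card {y \<in> ?D - {x}. x * y \<in> ?D} = card (?D - {x})"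
      by (rule arg_cong)
  qed
  also have "\<dots> = (\<Sum>x\<in>D3. card D2 + card D3 - 1)"
    using fin disj by (intro sum.cong) (auto simp: card_Un_disjoint)
  finally show ?thesis by (simp add: twice_g_eq_card_closed_pairs[OF assms(1-3)])
qed

text \<open>
  For \<open>x \<in> D1\<close>, the columns \<open>y \<in> D1 - {x}\<close> whose product with \<open>x\<close> misses \<open>D1 \<union> D2\<close> are the translates
  \<open>x * z\<close> by \<open>x\<close> of those \<open>z\<close> in the complement of \<open>D1 \<union> D2\<close> that are moved into \<open>D1\<close>.
\<close>

lemma twice_N2_eq_sum:
  assumes sub: "D1 \<subseteq> H" "D2 \<subseteq> H" and disj: "D1 \<inter> D2 = {}"
  shows "int (2 * N2 D1 D2)
    = (\<Sum>x\<in>D1. int (card D1) - 1 - int (card {z \<in> H - (D1 \<union> D2). x * z \<in> D1}))"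
proof -
  let ?D3 = "H - (D1 \<union> D2)"
  have fin: "finite D1" using sub finite_subset_columns by auto
  have "card (closed_pairs D1 D1 (D1 \<union> D2)) = (\<Sum>x\<in>D1. card {y \<in> D1 - {x}. x * y \<in> D1 \<union> D2})"
    using fin by (simp add: closed_pairs_def)
  then have "int (2 * N2 D1 D2) = (\<Sum>x\<in>D1. int (card {y \<in> D1 - {x}. x * y \<in> D1 \<union> D2}))"
    by (simp add: twice_N2_eq_card_closed_pairs[OF assms])
  also have "\<dots> = (\<Sum>x\<in>D1. int (card D1) - 1 - int (card {z \<in> ?D3. x * z \<in> D1}))"
  proof (rule sum.cong[OF refl])
    fix x assume x: "x \<in> D1"
    then have xH: "x \<in> H" using sub by auto
    let ?lost = "{y \<in> D1 - {x}. x * y \<in> ?D3}"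
    have "{z \<in> ?D3. x * z \<in> D1} = (*) x ` ?lost"
    proof (intro set_eqI iffI)
      fix z assume z: "z \<in> {z \<in> ?D3. x * z \<in> D1}"
      then have "x * z \<noteq> x" using mult_neq_left[OF xH] by auto
      with z show "z \<in> (*) x ` ?lost"
        by (intro image_eqI[of _ _ "x * z"]) (auto simp: mult_cancel_column[OF xH])
    qed (auto simp: mult_cancel_column[OF xH])
    then have "card {z \<in> ?D3. x * z \<in> D1} = card ?lost"
      by (simp add: card_image[OF inj_on_mult_column[OF xH]])
    moreover have "card {y \<in> D1 - {x}. x * y \<in> D1 \<union> D2} + card ?lost = card (D1 - {x})"
    proof -
      have "x * y \<in> D1 \<union> D2 \<or> x * y \<in> ?D3" if "y \<in> D1 - {x}" for y
        using that xH sub mult_closed[of x y] by auto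
      then have "D1 - {x} = {y \<in> D1 - {x}. x * y \<in> D1 \<union> D2} \<union> ?lost"
        by blast
      then have "card (D1 - {x}) = card ({y \<in> D1 - {x}. x * y \<in> D1 \<union> D2} \<union> ?lost)"
        by (rule arg_cong)
      also have "\<dots> = card {y \<in> D1 - {x}. x * y \<in> D1 \<union> D2} + card ?lost"
        using fin by (intro card_Un_disjoint) auto
      finally show ?thesis ..
    qed
    moreover have "card D1 > 0" using x fin card_gt_0_iff by blast
    ultimately show "int (card {y \<in> D1 - {x}. x * y \<in> D1 \<union> D2})
        = int (card D1) - 1 - int (card {z \<in> ?D3. x * z \<in> D1})"
      using x fin by simp
  qed
  finally show ?thesis .
qed

lemma twice_N2_ge:
  assumes sub: "D1 \<subseteq> H" "D2 \<subseteq> H" and disj: "D1 \<inter> D2 = {}"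
  shows "int (card D1) * (int (card D1) - 1 - int (card (H - (D1 \<union> D2)))) \<le> int (2 * N2 D1 D2)"
proof -
  have "card {z \<in> H - (D1 \<union> D2). x * z \<in> D1} \<le> card (H - (D1 \<union> D2))" for x
    using finite_columns by (intro card_mono) auto
  then have "(\<Sum>x\<in>D1. int (card D1) - 1 - int (card (H - (D1 \<union> D2)))) \<le> int (2 * N2 D1 D2)"
    unfolding twice_N2_eq_sum[OF assms] by (intro sum_mono) simp
  then show ?thesis by simp
qed

text \<open>
  When \<open>D1\<close> is the complement of a subspace \<open>K\<close>, the columns outside \<open>D1 \<union> D2\<close> lie in \<open>K\<close>, and
  multiplication by an element of \<open>K\<close> preserves \<open>D1\<close>; hence nothing is lost in the estimate above.
\<close>

lemma twice_N2_complement_eq: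
  assumes K: "K \<subseteq> H" "column_space K" and D2: "D2 \<subseteq> K"
  defines "D1 \<equiv> H - K"
  shows "int (2 * N2 D1 D2) = int (card D1) * (int (card D1) - 1 - int (card (H - (D1 \<union> D2))))"
proof -
  interpret K: column_space K by (rule K)
  have "x * z \<in> D1" if x: "x \<in> D1" and z: "z \<in> H - (D1 \<union> D2)" for x z
  proof -
    have xH: "x \<in> H" and xK: "x \<notin> K" and zK: "z \<in> K" and zH: "z \<in> H"
      using x z by (auto simp: D1_def)
    \<comment> \<open>If \<open>x * z\<close> were in \<open>K\<close>, then so would be \<open>x = z * (x * z)\<close>.\<close>
    have "x * z \<notin> K"
      using K.mult_closed[of z "x * z"] zK xK mult_neq_right[OF xH zH]
        mult_cancel_column[OF zH, of x] by (auto simp: mult.commute)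
    moreover have "x * z \<in> H" using xH zH xK zK by (intro mult_closed) auto
    ultimately show ?thesis by (simp add: D1_def)
  qed
  then have "{z \<in> H - (D1 \<union> D2). x * z \<in> D1} = H - (D1 \<union> D2)" if "x \<in> D1" for x
    using that by blast
  then have "(\<Sum>x\<in>D1. int (card D1) - 1 - int (card {z \<in> H - (D1 \<union> D2). x * z \<in> D1}))
      = (\<Sum>x\<in>D1. int (card D1) - 1 - int (card (H - (D1 \<union> D2))))"
    by (intro sum.cong refl) (simp only:)
  moreover have "D1 \<subseteq> H" "D2 \<subseteq> H" "D1 \<inter> D2 = {}" using K(1) D2 by (auto simp: D1_def)
  ultimately show ?thesis by (simp only: twice_N2_eq_sum sum_constant of_nat_id)
qed

end

section \<open>Saturated designs\<close>

lemma full_factorial_level: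
  assumes "full_factorial k a" "i \<in> {1..k}"
  shows "a i x * a i x = 1"
proof -
  have "(\<lambda>i\<in>{1..k}. a i x) \<in> {1..k} \<rightarrow>\<^sub>E {-1, 1}"
    using assms(1) unfolding full_factorial_def by (rule bij_betw_apply) simp
  then have "(\<lambda>i\<in>{1..k}. a i x) i \<in> {-1, 1}"
    using assms(2) by (rule PiE_mem)
  then show ?thesis using assms(2) by auto
qed

text \<open>
  Levels square to \<open>1\<close>, so a factor common to both products cancels and the index sets combine by
  symmetric difference.
\<close>

lemma prod_columns_mult:
  assumes a: "full_factorial k a" and S: "S \<subseteq> {1..k}" and T: "T \<subseteq> {1..k}"
  shows "(\<lambda>x. \<Prod>i\<in>S. a i x) * (\<lambda>x. \<Prod>i\<in>T. a i x) = (\<lambda>x. \<Prod>i\<in>(S - T) \<union> (T - S). a i x)"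
proof
  fix x
  have fin: "finite S" "finite T" using S T finite_subset by auto
  have "(\<Prod>i\<in>S. a i x) = (\<Prod>i\<in>S \<inter> T. a i x) * (\<Prod>i\<in>S - T. a i x)"
    by (rule prod.Int_Diff[OF fin(1)])
  moreover have "(\<Prod>i\<in>T. a i x) = (\<Prod>i\<in>S \<inter> T. a i x) * (\<Prod>i\<in>T - S. a i x)"
    using prod.Int_Diff[OF fin(2), of _ S] by (simp add: Int_commute)
  moreover have "(\<Prod>i\<in>(S - T) \<union> (T - S). a i x) = (\<Prod>i\<in>S - T. a i x) * (\<Prod>i\<in>T - S. a i x)"
    using fin by (intro prod.union_disjoint) auto
  moreover have "(\<Prod>i\<in>S \<inter> T. a i x) * (\<Prod>i\<in>S \<inter> T. a i x) = 1"
    unfolding prod.distrib[symmetric]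
    using S by (intro prod.neutral ballI full_factorial_level[OF a]) auto
  ultimately show "((\<lambda>x. \<Prod>i\<in>S. a i x) * (\<lambda>x. \<Prod>i\<in>T. a i x)) x
      = (\<Prod>i\<in>(S - T) \<union> (T - S). a i x)"
    by (simp add: algebra_simps)
qed

text \<open>
  Independence of the generating columns: a full factorial contains a run in which exactly one of
  the factors of a nonempty product is at level \<open>-1\<close>.
\<close>

lemma prod_columns_neq_one:
  assumes a: "full_factorial k a" and S: "S \<subseteq> {1..k}" and ne: "S \<noteq> {}"
  shows "(\<lambda>x. \<Prod>i\<in>S. a i x) \<noteq> 1"
proof
  assume one: "(\<lambda>x. \<Prod>i\<in>S. a i x) = 1"
  obtain j where j: "j \<in> S" using ne by auto
  define f where "f = (\<lambda>i\<in>{1..k}. if i = j then -1 else (1::int))"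
  have "f \<in> {1..k} \<rightarrow>\<^sub>E {-1, 1}" by (auto simp: f_def)
  then have "f \<in> range (\<lambda>x. \<lambda>i\<in>{1..k}. a i x)"
    using a by (simp only: full_factorial_def bij_betw_def)
  then obtain x where x: "f = (\<lambda>i\<in>{1..k}. a i x)"
    by (rule imageE)
  have "a i x = (if i = j then -1 else 1)" if "i \<in> S" for i
    using fun_cong[OF x, of i] that S by (auto simp: f_def split: if_splits)
  then have "(\<Prod>i\<in>S. a i x) = (\<Prod>i\<in>S. if i = j then -1 else 1)"
    by (intro prod.cong) auto
  also have "\<dots> = -1"
    using j S finite_subset[of S "{1..k}"] by simp
  finally show False using fun_cong[OF one, of x] by simp
qed

lemma column_space_saturated:
  assumes a: "full_factorial k a" and m: "m \<le> k"
  shows "column_space (saturated a m)"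
proof
  let ?c = "\<lambda>S x. \<Prod>i\<in>S. a i x"
  have sat: "saturated a m = ?c ` {S. S \<subseteq> {1..m} \<and> S \<noteq> {}}"
    by (auto simp: saturated_def)
  have sub: "S \<subseteq> {1..k}" if "S \<subseteq> {1..m}" for S
    using that m by fastforce
  show "finite (saturated a m)" unfolding sat
    by (rule finite_imageI, rule finite_subset[of _ "Pow {1..m}"]) auto
  show "1 \<notin> saturated a m"
  proof
    assume "1 \<in> saturated a m"
    then obtain S where S: "S \<subseteq> {1..m}" "S \<noteq> {}" and "1 = ?c S"
      unfolding sat by (elim imageE CollectE conjE)
    then show False using prod_columns_neq_one[OF a sub[OF S(1)] S(2)] by simp
  qed
  show "x * x = 1" if x: "x \<in> saturated a m" for x
  proof -
    obtain S where "S \<subseteq> {1..m}" "x = ?c S" using x by (auto simp: sat)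
    then show ?thesis using prod_columns_mult[OF a sub sub, of S S] by (simp add: one_fun_def)
  qed
  show "x * y \<in> saturated a m" if xy: "x \<in> saturated a m" "y \<in> saturated a m" "x \<noteq> y" for x y
  proof -
    obtain S T where S: "S \<subseteq> {1..m}" "x = ?c S" and T: "T \<subseteq> {1..m}" "y = ?c T"
      using xy by (auto simp: sat)
    then have "x * y = ?c ((S - T) \<union> (T - S))"
      using prod_columns_mult[OF a sub sub] by simp
    moreover have "(S - T) \<union> (T - S) \<noteq> {}" using S T xy(3) by auto
    ultimately show ?thesis unfolding sat using S(1) T(1)
      by (intro image_eqI[of _ _ "(S - T) \<union> (T - S)"] CollectI conjI Un_least) blast+
  qed
qed

lemma saturated_mono: "m \<le> n \<Longrightarrow> saturated a m \<subseteq> saturated a n"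
  unfolding saturated_def by (intro Collect_mono ex_mono) auto

theorem theorem3:
  fixes a :: "nat \<Rightarrow> 'r \<Rightarrow> int"
    and k r :: nat
    and D2 D3 :: "('r \<Rightarrow> int) set"
  assumes "full_factorial k a"
    and "1 \<le> r" and "r \<le> k - 1"
    and "D2 \<inter> D3 = {}" and "D2 \<union> D3 = saturated a r"
  shows "maximizes_g (saturated a k) D2 D3 \<and>
         min_weak_aberration (saturated a k) (saturated a k - saturated a r) D2"
proof
  let ?H = "saturated a k" and ?K = "saturated a r"
  have rk: "r \<le> k" using assms(3) by simp
  interpret H: column_space ?H by (rule column_space_saturated[OF assms(1) order.refl])
  have K: "column_space ?K" by (rule column_space_saturated[OF assms(1) rk])
  have KH: "?K \<subseteq> ?H" by (rule saturated_mono[OF rk])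
  have sub: "D2 \<subseteq> ?H" "D3 \<subseteq> ?H" and D2K: "D2 \<subseteq> ?K" using KH assms(5) by auto
  show "maximizes_g ?H D2 D3"
    unfolding maximizes_g_def
  proof (intro conjI allI impI)
    show "disjoint_pair ?H D2 D3" using sub assms(4) by (simp add: disjoint_pair_def)
    fix D2' D3'
    assume "disjoint_pair ?H D2' D3' \<and> card D2' = card D2 \<and> card D3' = card D3"
    then have "2 * g D2' D3' \<le> card D3 * (card D2 + card D3 - 1)"
      using H.twice_g_le[of D2' D3'] by (simp add: disjoint_pair_def)
    also have "\<dots> = 2 * g D2 D3"
      using H.twice_g_eq[OF sub assms(4)] K assms(5) by simp
    finally show "g D2' D3' \<le> g D2 D3" by simp
  qed
  show "min_weak_aberration ?H (?H - ?K) D2"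
    unfolding min_weak_aberration_def
  proof (intro conjI allI impI)
    show pair: "disjoint_pair ?H (?H - ?K) D2" using sub D2K by (auto simp: disjoint_pair_def)
    fix D1' D2'
    assume asm: "disjoint_pair ?H D1' D2' \<and> card D1' = card (?H - ?K) \<and> card D2' = card D2"
    have rest: "card (?H - (X \<union> Y)) = card ?H - (card X + card Y)" if "disjoint_pair ?H X Y" for X Y
    proof -
      have "X \<subseteq> ?H" "Y \<subseteq> ?H" "X \<inter> Y = {}" using that by (auto simp: disjoint_pair_def)
      moreover from this have "finite X" "finite Y" using H.finite_subset_columns by auto
      ultimately show ?thesis by (simp add: card_Diff_subset card_Un_disjoint)
    qed
    have "card (?H - (D1' \<union> D2')) = card (?H - (?H - ?K \<union> D2))"
      using rest[OF pair] rest[of D1' D2'] asm by simp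
    \<comment> \<open>So the lower bound for the competitor is the value attained by the given pair.\<close>
    then have "int (2 * N2 (?H - ?K) D2) \<le> int (2 * N2 D1' D2')"
      using H.twice_N2_ge[of D1' D2'] asm H.twice_N2_complement_eq[OF KH K D2K]
      by (simp add: disjoint_pair_def)
    then show "N2 (?H - ?K) D2 \<le> N2 D1' D2'" by simp
  qed
qed

end
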